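(* Let $N\ge2$ and let $H=(h_{i,j})\in\mathbb{R}^{(N-1)\times(N-1)}$ be lower triangular with $P(N-1,m)=\frac1N\binom{N}{m+1}$ for $m=1,\dots,N-1$. Then the linear system $s(\lambda)=0$ (i.e. $s_{k,j}(H,\lambda)=0$ for all $1\le j\le k\le N$) in the unknowns $\lambda=(\lambda_{k,j})_{1\le j<k\le N}$ has a unique solution $\lambda^\star$, given by $$\lambda^\star_{N,j}=\frac1{D(N)}\sum_{m=1}^{N-1}(-1)^{m-1}Q(N-1,m,j)=N\sum_{m=1}^{N-j}(-1)^{m-1}Q(N-1,m,j),\qquad j=1,\dots,N-1,$$ and, for $k=1,\dots,N-1$ and $j=1,\dots,k-1$, $$\begin{aligned}\lambda^\star_{k,j}&=\frac1{D(N)}\sum_{\ell=1}^{N-1}\sum_{m=1}^{N-1}(-1)^{\ell+m-1}\binom{\ell+m}{m}Q(N-1,\ell,j)Q(N-1,m,k)\\&=N\sum_{\ell=1}^{N-j}\sum_{m=1}^{N-k}(-1)^{\ell+m-1}\binom{\ell+m}{m}Q(N-1,\ell,j)Q(N-1,m,k).\end{aligned}$$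
   Context: For lower triangular $H=(h_{i,j})\in\mathbb{R}^{(N-1)\times(N-1)}$ (the dependence on $H$ is suppressed), set $P(N-1,0)=1$ and for $m=1,\dots,N-1$ $$P(N-1,m)=\sum_{1\le j(1)\le i(1)<j(2)\le i(2)<\cdots<j(m)\le i(m)\le N-1}\ \prod_{r=1}^m h_{i(r),j(r)},$$ $$D(N)=\sum_{m=0}^{N-1}(-1)^mP(N-1,m),$$ and for $m,j\in\{1,\dots,N-1\}$ $$Q(N-1,m,j)=\sum_{j=j(1)\le i(1)<j(2)\le i(2)<\cdots<j(m)\le i(m)\le N-1}\ \prod_{r=1}^m h_{i(r),j(r)}$$ (empty sums are $0$). The quantities $s_{k,j}(H,\lambda)$, $1\le j\le k\le N$, are defined as the coefficients of $\langle g_k,g_j\rangle$ in the formal expansion, in vector variables $g_1,\dots,g_N$, $$N\|g_N\|^2+\langle g_N,x_N-y_0\rangle+\sum_{k=1}^N\sum_{j=1}^{k-1}\lambda_{k,j}\langle x_k-x_j,g_k-g_j\rangle=\sum_{k=1}^N\sum_{j=1}^ks_{k,j}(H,\lambda)\langle g_k,g_j\rangle,$$ where $x_k=y_0-g_k-\sum_{i=1}^{k-1}\sum_{j=1}^i2h_{i,j}g_j$ for $k=1,\dots,N$ (the vector $y_0$ cancels). Each $s_{k,j}(H,\lambda)$ is affine in $\lambda$. *)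

theory Defs
  imports "HOL-Analysis.Analysis"
begin

text \<open>
  Matrices and multipliers are functions \<open>nat \<Rightarrow> nat \<Rightarrow> real\<close>; apart from \<open>lower_triangular\<close>, the definitions
  below read \<open>H i j\<close> only for \<open>1 \<le> j \<le> i \<le> N - 1\<close> and \<open>lam k j\<close> only for \<open>1 \<le> j < k \<le> N\<close>.
\<close>

definition lower_triangular :: "nat \<Rightarrow> (nat \<Rightarrow> nat \<Rightarrow> real) \<Rightarrow> bool" where
  "lower_triangular n H \<longleftrightarrow> (\<forall>i\<in>{1..n}. \<forall>j\<in>{1..n}. i < j \<longrightarrow> H i j = 0)"

text \<open>
  Pairs \<open>(i, j)\<close> of index sequences with
  \<open>1 \<le> j(1) \<le> i(1) < j(2) \<le> i(2) < \<dots> < j(m) \<le> i(m) \<le> n\<close>; the extensional function space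
  makes each pair of sequences be represented exactly once.
\<close>

definition index_chains :: "nat \<Rightarrow> nat \<Rightarrow> ((nat \<Rightarrow> nat) \<times> (nat \<Rightarrow> nat)) set" where
  "index_chains n m = {(i, j). i \<in> {1..m} \<rightarrow>\<^sub>E {1..n} \<and> j \<in> {1..m} \<rightarrow>\<^sub>E {1..n} \<and>
     (\<forall>r\<in>{1..m}. j r \<le> i r) \<and> (\<forall>r\<in>{1..<m}. i r < j (Suc r))}"

definition P :: "(nat \<Rightarrow> nat \<Rightarrow> real) \<Rightarrow> nat \<Rightarrow> nat \<Rightarrow> real" where
  "P H n m = (\<Sum>(i, j)\<in>index_chains n m. \<Prod>r=1..m. H (i r) (j r))"

definition D :: "(nat \<Rightarrow> nat \<Rightarrow> real) \<Rightarrow> nat \<Rightarrow> real" where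
  "D H N = (\<Sum>m=0..N-1. (-1) ^ m * P H (N-1) m)"

definition Q :: "(nat \<Rightarrow> nat \<Rightarrow> real) \<Rightarrow> nat \<Rightarrow> nat \<Rightarrow> nat \<Rightarrow> real" where
  "Q H n m a = (\<Sum>(i, j)\<in>{(i, j)\<in>index_chains n m. j 1 = a}. \<Prod>r=1..m. H (i r) (j r))"

lemma finite_index_chains: "finite (index_chains n m)"
proof (rule finite_subset)
  show "index_chains n m \<subseteq> ({1..m} \<rightarrow>\<^sub>E {1..n}) \<times> ({1..m} \<rightarrow>\<^sub>E {1..n})"
    by (auto simp: index_chains_def)
  show "finite (({1..m} \<rightarrow>\<^sub>E {1..n}) \<times> ({1..m} \<rightarrow>\<^sub>E {1..n}))"
    by (intro finite_cartesian_product finite_PiE) auto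
qed

lemma P_0: "P H n 0 = 1"
proof -
  have "index_chains n 0 = {(\<lambda>_. undefined, \<lambda>_. undefined)}"
    by (auto simp: index_chains_def)
  then show ?thesis
    by (simp add: P_def)
qed

text \<open>Under the assumption of this lemma \<open>1 / D H N\<close> is thus a genuine division.\<close>

lemma D_eq:
  assumes "N \<ge> 1" and "\<And>m. m \<in> {1..N-1} \<Longrightarrow> P H (N-1) m = 1 / real N * real (N choose (m+1))"
  shows "D H N = 1 / real N"
proof -
  have "D H N = (\<Sum>m=0..N-1. (-1) ^ m * (1 / real N * real (N choose Suc m)))"
    unfolding D_def
  proof (rule sum.cong)
    fix m assume "m \<in> {0..N-1}"
    then show "(-1) ^ m * P H (N-1) m = (-1) ^ m * (1 / real N * real (N choose Suc m))"
      using assms by (cases "m = 0") (auto simp: P_0)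
  qed simp
  also have "\<dots> = 1 / real N * (\<Sum>m=0..N-1. (-1) ^ m * real (N choose Suc m))"
    by (simp add: sum_distrib_left mult_ac)
  also have "(\<Sum>m=0..N-1. (-1) ^ m * real (N choose Suc m)) = 1"
  proof -
    obtain M where M: "N = Suc M"
      using assms(1) by (cases N) auto
    have "(\<Sum>i\<le>N. (-1) ^ i * real (N choose i)) = 0"
      using assms(1) choose_alternating_sum[where 'a = real, of N] by simp
    also have "(\<Sum>i\<le>N. (-1) ^ i * real (N choose i))
        = 1 + (\<Sum>i\<le>M. (-1) ^ Suc i * real (N choose Suc i))"
      unfolding M by (subst sum.atMost_Suc_shift) simp
    also have "\<dots> = 1 - (\<Sum>i\<le>M. (-1) ^ i * real (N choose Suc i))"
      by (simp only: power_Suc mult_minus1 mult_minus_left sum_negf) simp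
    finally show ?thesis
      by (simp only: M atLeast0AtMost diff_Suc_1)
  qed
  finally show ?thesis
    by simp
qed

text \<open>
  A formal linear combination of the vector variables \<open>y\<^sub>0, g\<^sub>1, g\<^sub>2, \<dots>\<close> is its coefficient
  function, with index \<open>0\<close> standing for \<open>y\<^sub>0\<close> and index \<open>i \<ge> 1\<close> for \<open>g\<^sub>i\<close>.
\<close>

type_synonym fvec = "nat \<Rightarrow> real"

definition fvar :: "nat \<Rightarrow> fvec" where
  "fvar i = (\<lambda>n. if n = i then 1 else 0)"

definition fsub :: "fvec \<Rightarrow> fvec \<Rightarrow> fvec" where
  "fsub u v = (\<lambda>n. u n - v n)"

definition x_form :: "(nat \<Rightarrow> nat \<Rightarrow> real) \<Rightarrow> nat \<Rightarrow> fvec" where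
  "x_form H k = (\<lambda>n. fvar 0 n - fvar k n - (\<Sum>i=1..k-1. \<Sum>j=1..i. 2 * H i j * fvar j n))"

text \<open>
  The coefficient of the monomial \<open>\<langle>v\<^sub>k, v\<^sub>j\<rangle>\<close>, \<open>j \<le> k\<close>, in the expansion of the formal inner product
  of \<open>u\<close> and \<open>w\<close>, where \<open>\<langle>v\<^sub>k, v\<^sub>j\<rangle>\<close> and \<open>\<langle>v\<^sub>j, v\<^sub>k\<rangle>\<close> are the same monomial.
\<close>

definition ip_coeff :: "fvec \<Rightarrow> fvec \<Rightarrow> nat \<Rightarrow> nat \<Rightarrow> real" where
  "ip_coeff u w k j = (if k = j then u k * w k else u k * w j + u j * w k)"

definition s_coeff :: "nat \<Rightarrow> (nat \<Rightarrow> nat \<Rightarrow> real) \<Rightarrow> (nat \<Rightarrow> nat \<Rightarrow> real) \<Rightarrow> nat \<Rightarrow> nat \<Rightarrow> real" where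
  "s_coeff N H lam k j =
     real N * ip_coeff (fvar N) (fvar N) k j
     + ip_coeff (fvar N) (fsub (x_form H N) (fvar 0)) k j
     + (\<Sum>k'=1..N. \<Sum>j'=1..k'-1.
          lam k' j' * ip_coeff (fsub (x_form H k') (x_form H j')) (fsub (fvar k') (fvar j')) k j)"

text \<open>
  The coefficients \<open>s_coeff N H lam k j\<close> do realise the expansion in every real inner product space
  (lemma \<open>s_coeff_expansion\<close>), and they are the only ones that do (lemma \<open>s_coeff_unique\<close>).
\<close>

definition x_vec :: "(nat \<Rightarrow> nat \<Rightarrow> real) \<Rightarrow> 'a::real_inner \<Rightarrow> (nat \<Rightarrow> 'a) \<Rightarrow> nat \<Rightarrow> 'a" where
  "x_vec H y0 g k = y0 - g k - (\<Sum>i=1..k-1. \<Sum>j=1..i. (2 * H i j) *\<^sub>R g j)"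

definition expansion_lhs ::
  "nat \<Rightarrow> (nat \<Rightarrow> nat \<Rightarrow> real) \<Rightarrow> (nat \<Rightarrow> nat \<Rightarrow> real) \<Rightarrow> 'a::real_inner \<Rightarrow> (nat \<Rightarrow> 'a) \<Rightarrow> real" where
  "expansion_lhs N H lam y0 g =
     real N * (norm (g N))\<^sup>2 + g N \<bullet> (x_vec H y0 g N - y0)
     + (\<Sum>k=1..N. \<Sum>j=1..k-1. lam k j * ((x_vec H y0 g k - x_vec H y0 g j) \<bullet> (g k - g j)))"

definition evalv :: "nat \<Rightarrow> (nat \<Rightarrow> 'a::real_inner) \<Rightarrow> fvec \<Rightarrow> 'a" where
  "evalv N v u = (\<Sum>n\<le>N. u n *\<^sub>R v n)"

lemma evalv_fvar: "i \<le> N \<Longrightarrow> evalv N v (fvar i) = v i"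
  by (simp add: evalv_def fvar_def if_distrib[of "\<lambda>c. c *\<^sub>R _"] cong: if_cong)

lemma evalv_fsub: "evalv N v (fsub a b) = evalv N v a - evalv N v b"
  by (simp add: evalv_def fsub_def scaleR_left_diff_distrib sum_subtractf)

lemma evalv_sum: "evalv N v (\<lambda>n. \<Sum>i\<in>A. f i n) = (\<Sum>i\<in>A. evalv N v (f i))"
  unfolding evalv_def by (subst sum.swap) (simp add: scaleR_sum_left)

lemma evalv_scale: "evalv N v (\<lambda>n. c * a n) = c *\<^sub>R evalv N v a"
  by (simp add: evalv_def scaleR_sum_right)

lemma evalv_x_form:
  assumes "k \<in> {1..N}"
  shows "evalv N v (x_form H k) = x_vec H (v 0) v k"
proof -
  have "x_form H k = fsub (fsub (fvar 0) (fvar k)) (\<lambda>n. \<Sum>i=1..k-1. \<Sum>j=1..i. 2 * H i j * fvar j n)"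
    by (simp add: x_form_def fsub_def)
  moreover have "evalv N v (\<lambda>n. \<Sum>i=1..k-1. \<Sum>j=1..i. 2 * H i j * fvar j n)
      = (\<Sum>i=1..k-1. \<Sum>j=1..i. (2 * H i j) *\<^sub>R evalv N v (fvar j))"
    by (simp only: evalv_sum evalv_scale)
  moreover have "(\<Sum>i=1..k-1. \<Sum>j=1..i. (2 * H i j) *\<^sub>R evalv N v (fvar j))
      = (\<Sum>i=1..k-1. \<Sum>j=1..i. (2 * H i j) *\<^sub>R v j)"
    using assms by (intro sum.cong refl arg_cong[where f = "(*\<^sub>R) _"] evalv_fvar) auto
  moreover have "evalv N v (fvar 0) = v 0" "evalv N v (fvar k) = v k"
    using assms by (auto intro: evalv_fvar)
  ultimately show ?thesis
    by (simp only: evalv_fsub x_vec_def)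
qed

lemma inner_evalv:
  "evalv N v a \<bullet> evalv N v b = (\<Sum>k\<le>N. \<Sum>j\<le>k. ip_coeff a b k j * (v k \<bullet> v j))"
proof (induction N)
  case 0
  then show ?case by (simp add: evalv_def ip_coeff_def)
next
  case (Suc N)
  let ?w = "v (Suc N)"
  have split: "evalv (Suc N) v c = evalv N v c + c (Suc N) *\<^sub>R ?w" for c
    by (simp add: evalv_def)
  have pull: "?w \<bullet> evalv N v c = (\<Sum>j\<le>N. c j * (?w \<bullet> v j))" for c
    by (simp add: evalv_def inner_sum_right)
  have "(\<Sum>j\<le>Suc N. ip_coeff a b (Suc N) j * (?w \<bullet> v j))
      = (\<Sum>j\<le>N. a (Suc N) * (b j * (?w \<bullet> v j)) + b (Suc N) * (a j * (?w \<bullet> v j)))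
        + a (Suc N) * b (Suc N) * (?w \<bullet> ?w)"
    by (auto simp: ip_coeff_def algebra_simps intro!: sum.cong)
  also have "\<dots> = a (Suc N) * (?w \<bullet> evalv N v b) + b (Suc N) * (?w \<bullet> evalv N v a)
        + a (Suc N) * b (Suc N) * (?w \<bullet> ?w)"
    by (simp add: pull sum.distrib sum_distrib_left)
  finally show ?case
    by (simp add: split Suc inner_commute algebra_simps)
qed

lemma s_coeff_row_0:
  assumes "N \<ge> 1"
  shows "s_coeff N H lam k 0 = 0"
proof -
  have g: "fvar k' 0 = 0" if "k' \<ge> 1" for k'
    using that by (simp add: fvar_def)
  have x0: "x_form H k' 0 = 1" if "k' \<ge> 1" for k'
    using that by (simp add: x_form_def fvar_def)
  have ip: "ip_coeff a b k 0 = 0" if "a 0 = 0" "b 0 = 0" for a b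
    using that by (simp add: ip_coeff_def)
  have "ip_coeff (fsub (x_form H k') (x_form H j')) (fsub (fvar k') (fvar j')) k 0 = 0"
    if "k' \<ge> 1" "j' \<ge> 1" for k' j'
    using that by (intro ip) (simp_all add: fsub_def x0 g)
  moreover have "ip_coeff (fvar N) (fsub (x_form H N) (fvar 0)) k 0 = 0"
    using assms by (intro ip) (simp_all add: fsub_def x0 g, simp add: fvar_def)
  moreover have "ip_coeff (fvar N) (fvar N) k 0 = 0"
    using assms by (intro ip) (simp_all add: g)
  ultimately show ?thesis
    by (simp add: s_coeff_def)
qed

lemma s_coeff_expansion:
  fixes g :: "nat \<Rightarrow> 'a::real_inner"
  assumes "N \<ge> 1"
  shows "expansion_lhs N H lam y0 g = (\<Sum>k=1..N. \<Sum>j=1..k. s_coeff N H lam k j * (g k \<bullet> g j))"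
proof -
  define v where "v = g(0 := y0)"
  let ?e = "evalv N v"
  have v: "v 0 = y0" "\<And>k. k \<ge> 1 \<Longrightarrow> v k = g k"
    by (auto simp: v_def)
  have xv: "x_vec H y0 g k = ?e (x_form H k)" if "k \<in> {1..N}" for k
    using that unfolding evalv_x_form[OF that] x_vec_def
    by (auto simp: v intro!: sum.cong)
  have gv: "g k = ?e (fvar k)" if "k \<in> {1..N}" for k
    using that by (simp add: evalv_fvar v)
  have yv: "y0 = ?e (fvar 0)"
    by (simp add: evalv_fvar v)
  have "expansion_lhs N H lam y0 g =
      real N * (?e (fvar N) \<bullet> ?e (fvar N)) + ?e (fvar N) \<bullet> ?e (fsub (x_form H N) (fvar 0))
      + (\<Sum>k=1..N. \<Sum>j=1..k-1.
           lam k j * (?e (fsub (x_form H k) (x_form H j)) \<bullet> ?e (fsub (fvar k) (fvar j))))"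
    unfolding expansion_lhs_def evalv_fsub power2_norm_eq_inner
    using assms
    by (intro arg_cong2[where f = "(+)"] arg_cong2[where f = "(*)"] arg_cong2[where f = inner]
        arg_cong2[where f = "(-)"] sum.cong refl xv gv yv) auto
  also have "\<dots> = (\<Sum>k\<le>N. \<Sum>j\<le>k. s_coeff N H lam k j * (v k \<bullet> v j))"
  proof -
    have swap: "(\<Sum>k'=1..N. \<Sum>j'=1..k'-1. lam k' j' * (\<Sum>k\<le>N. \<Sum>j\<le>k. F k' j' k j * (v k \<bullet> v j)))
        = (\<Sum>k\<le>N. \<Sum>j\<le>k. (\<Sum>k'=1..N. \<Sum>j'=1..k'-1. lam k' j' * F k' j' k j) * (v k \<bullet> v j))"
      for F :: "nat \<Rightarrow> nat \<Rightarrow> nat \<Rightarrow> nat \<Rightarrow> real"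
    proof -
      define A where "A = (SIGMA k:{1..N}. {1..k-1})"
      define B where "B = (SIGMA k:{..N}. {..k})"
      have A: "(\<Sum>k=1..N. \<Sum>j=1..k-1. f k j) = (\<Sum>p\<in>A. f (fst p) (snd p))" for f :: "nat \<Rightarrow> nat \<Rightarrow> real"
        unfolding A_def by (subst sum.Sigma) (auto simp: case_prod_beta)
      have B: "(\<Sum>k\<le>N. \<Sum>j\<le>k. f k j) = (\<Sum>p\<in>B. f (fst p) (snd p))" for f :: "nat \<Rightarrow> nat \<Rightarrow> real"
        unfolding B_def by (subst sum.Sigma) (auto simp: case_prod_beta)
      show ?thesis
        unfolding A B sum_distrib_left sum_distrib_right by (subst sum.swap) (simp add: mult.assoc)
    qed
    show ?thesis
      unfolding inner_evalv s_coeff_def swap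
      by (simp add: sum.distrib sum_distrib_left distrib_right mult.assoc)
  qed
  also have "\<dots> = (\<Sum>k=1..N. \<Sum>j=1..k. s_coeff N H lam k j * (v k \<bullet> v j))"
  proof -
    have row: "(\<Sum>j\<le>k. s_coeff N H lam k j * (v k \<bullet> v j)) = (\<Sum>j=1..k. s_coeff N H lam k j * (v k \<bullet> v j))" for k
      by (rule sum.mono_neutral_right) (auto simp: s_coeff_row_0[OF assms] not_le less_Suc_eq_0_disj)
    show ?thesis
      unfolding row by (rule sum.mono_neutral_right) (auto simp: not_le)
  qed
  also have "\<dots> = (\<Sum>k=1..N. \<Sum>j=1..k. s_coeff N H lam k j * (g k \<bullet> g j))"
    by (auto simp: v intro!: sum.cong)
  finally show ?thesis .
qed

lemma s_coeff_unique:
  assumes "N \<ge> 1"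
    and c: "\<And>(y0::real) g. expansion_lhs N H lam y0 g = (\<Sum>k=1..N. \<Sum>j=1..k. c k j * (g k \<bullet> g j))"
    and kj: "1 \<le> j" "j \<le> k" "k \<le> N"
  shows "c k j = s_coeff N H lam k j"
proof -
  define d where "d k j = c k j - s_coeff N H lam k j" for k j
  have d: "(\<Sum>k=1..N. \<Sum>j=1..k. d k j * (g k * g j)) = 0" for g :: "nat \<Rightarrow> real"
    using c[of 0 g] s_coeff_expansion[OF assms(1), of H lam 0 g]
    by (simp add: d_def left_diff_distrib sum_subtractf)
  have diag: "d a a = 0" if a: "a \<in> {1..N}" for a
  proof -
    have "0 = (\<Sum>k=1..N. \<Sum>j=1..k. d k j * (fvar a k * fvar a j))"
      using d[of "fvar a"] by simp
    also have "\<dots> = (\<Sum>k=1..N. if k = a then d a a else 0)"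
    proof (rule sum.cong)
      fix k assume "k \<in> {1..N}"
      then show "(\<Sum>j=1..k. d k j * (fvar a k * fvar a j)) = (if k = a then d a a else 0)"
        by (auto simp: fvar_def if_distrib cong: if_cong)
    qed simp
    finally show ?thesis using a by simp
  qed
  show ?thesis
  proof (cases "k = j")
    case True
    then show ?thesis using diag[of k] kj by (simp add: d_def)
  next
    case False
    let ?g = "\<lambda>n. fvar k n + fvar j n"
    have "0 = (\<Sum>k'=1..N. \<Sum>j'=1..k'. d k' j' * (?g k' * ?g j'))"
      using d[of ?g] by simp
    also have "\<dots> = (\<Sum>k'=1..N. if k' = k then d k j else 0)"
    proof (rule sum.cong)
      fix k' assume k': "k' \<in> {1..N}"
      have "(\<Sum>j'=1..k'. d k' j' * (?g k' * ?g j'))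
          = (\<Sum>j'=1..k'. if j' = j \<and> k' = k then d k j else 0)"
        using k' False kj diag by (intro sum.cong) (auto simp: fvar_def)
      then show "(\<Sum>j'=1..k'. d k' j' * (?g k' * ?g j')) = (if k' = k then d k j else 0)"
        using kj by auto
    qed simp
    finally show ?thesis using kj by (simp add: d_def)
  qed
qed

end

theory Submission
  imports Defs
begin

text \<open>
  Put \<open>A\<^sub>k\<^sub>j = \<Sum>i=j..<k. H i j\<close>, a strictly lower triangular \<open>N \<times> N\<close> matrix, and let \<open>L\<close> be the weighted
  graph Laplacian of \<open>lam\<close>. Up to a factor 2 off the diagonal, the \<open>s_coeff\<close> are the entries of
  \<open>R - (L + L A + A\<^sup>T L)\<close> with \<open>R = (N - 1) e e\<^sup>T - e e\<^sup>T A - A\<^sup>T e e\<^sup>T\<close> and \<open>e\<close> the last unit vector, so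
  \<open>s = 0\<close> is a Lyapunov equation for \<open>L\<close>. As \<open>A\<close> is strictly triangular, its solution is
  determined entry by entry, starting from the bottom right corner. With \<open>F\<close> the sum of
  \<open>(-1)^(l+m) * (l+m choose m) * (A\<^sup>T)^l e e\<^sup>T A^m\<close>, Pascal's rule gives \<open>F + F A + A\<^sup>T F = e e\<^sup>T\<close>, hence
  \<open>L = N F - e e\<^sup>T\<close> is that solution. The rows \<open>e\<^sup>T A^m\<close> consist of the numbers \<open>Q H (N - 1) m j\<close> and
  have sum \<open>P H (N - 1) m\<close>; the hypothesis on these sums and Vandermonde's identity make the rows of
  \<open>L\<close> sum to zero, that is, make \<open>L\<close> a Laplacian.
\<close>

section \<open>The linear system as a Lyapunov equation\<close>

definition partial_col_sum :: "(nat \<Rightarrow> nat \<Rightarrow> real) \<Rightarrow> nat \<Rightarrow> nat \<Rightarrow> real" where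
  "partial_col_sum H k j = (\<Sum>i=j..<k. H i j)"

text \<open>\<open>lam\<close> carries meaning only below the diagonal; \<open>max\<close> and
  \<open>min\<close> turn it into symmetric edge weights.\<close>

definition laplacian :: "nat \<Rightarrow> (nat \<Rightarrow> nat \<Rightarrow> real) \<Rightarrow> nat \<Rightarrow> nat \<Rightarrow> real" where
  "laplacian N lam k j =
     (if k = j then \<Sum>i\<in>{1..N} - {k}. lam (max k i) (min k i) else - lam (max k j) (min k j))"

fun row_iterate :: "nat \<Rightarrow> (nat \<Rightarrow> nat \<Rightarrow> real) \<Rightarrow> nat \<Rightarrow> nat \<Rightarrow> real" where
  "row_iterate N A 0 j = fvar N j"
| "row_iterate N A (Suc m) j = (\<Sum>i=1..N. row_iterate N A m i * A i j)"

text \<open>Cutting off at \<open>N\<close> loses nothing for strictly lower triangular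
  \<open>A\<close>, since then e^T A^N = 0.\<close>

definition lyapunov_series :: "nat \<Rightarrow> (nat \<Rightarrow> nat \<Rightarrow> real) \<Rightarrow> nat \<Rightarrow> nat \<Rightarrow> real" where
  "lyapunov_series N A k j =
     (\<Sum>l<N. \<Sum>m<N. (-1) ^ (l+m) * real ((l+m) choose m) * row_iterate N A l k * row_iterate N A m j)"

lemma partial_col_sum_eq_0: "k \<le> j \<Longrightarrow> partial_col_sum H k j = 0"
  by (simp add: partial_col_sum_def)

lemma laplacian_sym: "laplacian N lam k j = laplacian N lam j k"
  by (auto simp: laplacian_def max.commute min.commute)

text \<open>This is the Laplacian form g^T L f, a weighted sum of products of differences along
  edges, with g the \<open>j\<close>-th unit vector. Only edges at \<open>j\<close>
  contribute.\<close>

lemma edge_sum_eq_laplacian: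
  assumes "j \<in> {1..N}"
  shows "(\<Sum>k=1..N. \<Sum>i=1..k-1. lam k i * ((f k - f i) * (fvar k j - fvar i j)))
    = (\<Sum>i=1..N. laplacian N lam j i * f i)"
proof -
  let ?w = "\<lambda>i. lam (max j i) (min j i) * (f j - f i)"
  have "(\<Sum>k=1..N. \<Sum>i=1..k-1. lam k i * ((f k - f i) * (fvar k j - fvar i j)))
    = (\<Sum>k=1..N. (if k = j then \<Sum>i=1..j-1. ?w i else 0) + (if j < k then ?w k else 0))"
  proof (rule sum.cong)
    fix k assume "k \<in> {1..N}"
    \<comment> \<open>As \<open>i < k\<close>, at most one end of the edge is \<open>j\<close>. If
      it is the smaller end, both differences change sign and the product still has the form
      \<open>?w\<close>.\<close>
    have "(\<Sum>i=1..k-1. lam k i * ((f k - f i) * (fvar k j - fvar i j)))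
      = (\<Sum>i=1..k-1. (if k = j then ?w i else 0) + (if i = j then ?w k else 0))"
      by (intro sum.cong refl) (auto simp: fvar_def max_def min_def algebra_simps)
    also have "\<dots> = (if k = j then \<Sum>i=1..j-1. ?w i else 0) + (if j < k then ?w k else 0)"
      using assms by (auto simp: sum.distrib)
    finally show "(\<Sum>i=1..k-1. lam k i * ((f k - f i) * (fvar k j - fvar i j))) = \<dots>" .
  qed simp
  also have "\<dots> = (\<Sum>i=1..j-1. ?w i) + (\<Sum>k\<in>{k\<in>{1..N}. j < k}. ?w k)"
  proof -
    have "(\<Sum>k\<in>{k\<in>{1..N}. j < k}. ?w k) = (\<Sum>k=1..N. if j < k then ?w k else 0)"
      by (simp only: sum.inter_filter finite_atLeastAtMost)
    moreover have "(\<Sum>k=1..N. if k = j then \<Sum>i=1..j-1. ?w i else 0) = (\<Sum>i=1..j-1. ?w i)"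
      using assms by simp
    ultimately show ?thesis
      by (simp only: sum.distrib)
  qed
  also have "\<dots> = (\<Sum>i\<in>{1..j-1} \<union> {k\<in>{1..N}. j < k}. ?w i)"
    by (subst sum.union_disjoint) auto
  also have "{1..j-1} \<union> {k\<in>{1..N}. j < k} = {1..N} - {j}"
    using assms by auto
  also have "(\<Sum>i\<in>{1..N} - {j}. ?w i)
      = laplacian N lam j j * f j + (\<Sum>i\<in>{1..N} - {j}. laplacian N lam j i * f i)"
  proof -
    have "(\<Sum>i\<in>{1..N} - {j}. laplacian N lam j i * f i)
        = - (\<Sum>i\<in>{1..N} - {j}. lam (max j i) (min j i) * f i)"
      unfolding sum_negf[symmetric] by (intro sum.cong) (auto simp: laplacian_def)
    then show ?thesis
      by (simp add: laplacian_def right_diff_distrib sum_subtractf sum_distrib_right)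
  qed
  also have "\<dots> = (\<Sum>i=1..N. laplacian N lam j i * f i)"
    using assms by (subst (2) sum.remove[of _ j]) auto
  finally show ?thesis .
qed

text \<open>Collecting the coefficient of each g_n shows where A comes from: apart from the y_0
  coordinate, the x_k have coefficient matrix -(I + 2A).\<close>

lemma x_form_eq:
  assumes "n \<ge> 1"
  shows "x_form H k n = - fvar k n - 2 * partial_col_sum H k n"
proof -
  have "(\<Sum>i=1..k-1. \<Sum>j=1..i. 2 * H i j * fvar j n) = (\<Sum>i=1..k-1. if n \<le> i then 2 * H i n else 0)"
    using assms by (intro sum.cong refl) (auto simp: fvar_def if_distrib cong: if_cong)
  also have "\<dots> = (\<Sum>i\<in>{i\<in>{1..k-1}. n \<le> i}. 2 * H i n)"
    by (simp only: sum.inter_filter finite_atLeastAtMost)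
  also have "{i\<in>{1..k-1}. n \<le> i} = {n..<k}"
    using assms by auto
  finally show ?thesis
    using assms by (simp add: x_form_def partial_col_sum_def sum_distrib_left fvar_def)
qed

text \<open>The edge terms form the quadratic form of -L(I + 2A), whose symmetric part is -(L + L A
  + A^T L). A monomial with \<open>k \<noteq> j\<close> collects two equal symmetric entries, hence
  the factor 2.\<close>

lemma s_coeff_eq_lyapunov:
  fixes H lam :: "nat \<Rightarrow> nat \<Rightarrow> real"
  assumes k: "k \<in> {1..N}" and j: "j \<in> {1..N}"
  defines "A \<equiv> partial_col_sum H"
    and "L \<equiv> laplacian N lam"
  shows "s_coeff N H lam k j = (if k = j then 1 else 2) *
    ((real N - 1) * fvar N k * fvar N j - fvar N k * A N j - fvar N j * A N k
     - (L k j + (\<Sum>i=1..N. L k i * A i j) + (\<Sum>i=1..N. L j i * A i k)))"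
proof -
  have ip: "ip_coeff u w k j = (if k = j then 1/2 else 1) * (u k * w j + u j * w k)" for u w
    by (simp add: ip_coeff_def)
  \<comment> \<open>The two products in \<open>ip_coeff\<close> differ by exchanging the indices, so
    one ordered version, used twice, suffices.\<close>
  have half: "(\<Sum>k'=1..N. \<Sum>j'=1..k'-1. lam k' j' * ((x_form H k' a - x_form H j' a) * (fvar k' b - fvar j' b)))
      = - L a b - 2 * (\<Sum>i=1..N. L b i * A i a)" if "a \<in> {1..N}" "b \<in> {1..N}" for a b
  proof -
    have "(\<Sum>k'=1..N. \<Sum>j'=1..k'-1. lam k' j' * ((x_form H k' a - x_form H j' a) * (fvar k' b - fvar j' b)))
        = (\<Sum>i=1..N. L b i * (- fvar i a - 2 * A i a))"
      unfolding L_def A_def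
      using edge_sum_eq_laplacian[OF that(2), of lam "\<lambda>i. x_form H i a"] that(1)
      by (simp add: x_form_eq)
    also have "\<dots> = - (\<Sum>i=1..N. L b i * fvar i a) - 2 * (\<Sum>i=1..N. L b i * A i a)"
      unfolding sum_distrib_left sum_negf[symmetric] sum_subtractf[symmetric]
      by (intro sum.cong) (auto simp: algebra_simps)
    also have "(\<Sum>i=1..N. L b i * fvar i a) = L a b"
      using that laplacian_sym[of N lam a b]
      by (simp add: fvar_def L_def if_distrib cong: if_cong)
    finally show ?thesis .
  qed
  let ?c = "if k = j then 1/2 else 1 :: real"
  have T: "(\<Sum>k'=1..N. \<Sum>j'=1..k'-1.
          lam k' j' * ip_coeff (fsub (x_form H k') (x_form H j')) (fsub (fvar k') (fvar j')) k j)
      = ?c * ((- L k j - 2 * (\<Sum>i=1..N. L j i * A i k)) + (- L j k - 2 * (\<Sum>i=1..N. L k i * A i j)))"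
    unfolding half[OF k j, symmetric] half[OF j k, symmetric]
    unfolding sum.distrib[symmetric] sum_distrib_left
    by (intro sum.cong refl) (simp add: ip fsub_def algebra_simps)
  have x: "fsub (x_form H N) (fvar 0) n = - fvar N n - 2 * A N n" if "n \<in> {1..N}" for n
    using that by (simp add: fsub_def x_form_eq A_def) (simp add: fvar_def)
  have sym: "L j k = L k j"
    by (simp add: L_def laplacian_sym)
  show ?thesis
    unfolding s_coeff_def T unfolding ip x[OF k] x[OF j] sym
    by (simp add: algebra_simps)
qed

section \<open>Solving the Lyapunov equation\<close>

text \<open>Since \<open>A i j\<close> vanishes unless \<open>i > j\<close>, the two sums involve
  only entries of \<open>E\<close> with index sum above \<open>k + j\<close>, which are zero by
  induction.\<close>

lemma lyapunov_homogeneous_eq_0: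
  fixes E A :: "nat \<Rightarrow> nat \<Rightarrow> real"
  assumes A: "\<And>i j. i \<le> j \<Longrightarrow> A i j = 0"
    and E: "\<And>k j. k \<in> {1..N} \<Longrightarrow> j \<in> {1..N} \<Longrightarrow>
      E k j + (\<Sum>i=1..N. E k i * A i j) + (\<Sum>i=1..N. E j i * A i k) = 0"
    and kj: "k \<in> {1..N}" "j \<in> {1..N}"
  shows "E k j = 0"
  using kj
proof (induction "2 * N - (k + j)" arbitrary: k j rule: less_induct)
  case less
  \<comment> \<open>A general pair with the same index sum serves both sums, in which
    \<open>k\<close> and \<open>j\<close> exchange roles.\<close>
  have "E a i * A i b = 0" if "a + b = k + j" "a \<in> {1..N}" "b \<in> {1..N}" "i \<in> {1..N}" for a b i
  proof (cases "i \<le> b")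
    case False
    then have "E a i = 0"
      using that less.prems by (intro less.hyps) auto
    then show ?thesis by simp
  qed (simp add: A)
  then have "(\<Sum>i=1..N. E k i * A i j) = 0" "(\<Sum>i=1..N. E j i * A i k) = 0"
    using less.prems by (auto intro!: sum.neutral simp: add.commute)
  with E[OF less.prems] show ?case by simp
qed

text \<open>Each factor A strictly lowers the column index, so e^T A^m lives on the columns up to N
  - m.\<close>

lemma row_iterate_eq_0:
  assumes "\<And>i j. i \<le> j \<Longrightarrow> A i j = 0" and "N < j + m"
  shows "row_iterate N A m j = 0"
  using assms(2)
proof (induction m arbitrary: j)
  case 0
  then show ?case by (simp add: fvar_def)
next
  case (Suc m)
  have "row_iterate N A m i * A i j = 0" for i
    using Suc assms(1)[of i j] by (cases "i \<le> j") auto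
  then have "(\<Sum>i=1..N. row_iterate N A m i * A i j) = 0"
    by (intro sum.neutral ballI)
  then show ?case by simp
qed

lemma lyapunov_series_sym: "lyapunov_series N A k j = lyapunov_series N A j k"
proof -
  have b: "(l + m) choose m = (m + l) choose l" for l m :: nat
    using binomial_symmetric[of m "l + m"] by (simp add: add.commute)
  show ?thesis
    unfolding lyapunov_series_def
    by (subst sum.swap, intro sum.cong refl, subst b) (simp add: add.commute mult_ac)
qed

lemma lyapunov_series_eq:
  assumes A: "\<And>i j. i \<le> j \<Longrightarrow> A i j = 0" and N: "N \<ge> 1" and kj: "k \<in> {1..N}" "j \<in> {1..N}"
  shows "lyapunov_series N A k j + (\<Sum>i=1..N. lyapunov_series N A k i * A i j)
    + (\<Sum>i=1..N. lyapunov_series N A j i * A i k) = fvar N k * fvar N j"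
proof -
  let ?v = "row_iterate N A"
  \<comment> \<open>Right multiplication by \<open>A\<close> shifts \<open>m\<close> and so replaces the coefficient \<open>l + m choose m\<close> by \<open>- b l m\<close>.\<close>
  define b where "b l m = (if m = 0 then 0 else (l + (m - 1)) choose (m - 1))" for l m :: nat
  have shift: "(\<Sum>i=1..N. lyapunov_series N A p i * A i q)
      = (\<Sum>l<N. \<Sum>m<N. - ((-1) ^ (l+m) * real (b l m) * ?v l p * ?v m q))"
    if "q \<in> {1..N}" for p q
  proof -
    let ?h = "\<lambda>l m. - ((-1) ^ (l+m) * real (b l m) * ?v l p * ?v m q)"
    have "(\<Sum>i=1..N. lyapunov_series N A p i * A i q)
        = (\<Sum>l<N. \<Sum>m<N. \<Sum>i=1..N. (-1) ^ (l+m) * real ((l+m) choose m) * ?v l p * ?v m i * A i q)"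
      unfolding lyapunov_series_def sum_distrib_right
      by (rule trans[OF sum.swap], rule sum.cong[OF refl], rule sum.swap)
    also have "\<dots> = (\<Sum>l<N. \<Sum>m<N. ?h l (Suc m))"
      by (intro sum.cong refl) (simp add: b_def sum_distrib_left mult.assoc sum_negf)
    \<comment> \<open>The shifted index runs from 1 to N. The range can be reset because
      \<open>b\<close> kills the term at 0 and nilpotency the one at N.\<close>
    also have "\<dots> = (\<Sum>l<N. \<Sum>m<N. ?h l m)"
    proof (rule sum.cong[OF refl])
      fix l
      have "(\<Sum>m<N. ?h l (Suc m)) = (\<Sum>m<Suc N. ?h l m) - ?h l 0"
        by (subst sum.lessThan_Suc_shift) simp
      also have "?h l 0 = 0" by (simp add: b_def)
      also have "?v N q = 0"
        using that by (intro row_iterate_eq_0 A) auto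
      then have "(\<Sum>m<Suc N. ?h l m) - 0 = (\<Sum>m<N. ?h l m)" by simp
      finally show "(\<Sum>m<N. ?h l (Suc m)) = (\<Sum>m<N. ?h l m)" .
    qed
    finally show ?thesis .
  qed
  \<comment> \<open>\<open>b m l\<close> is the coefficient from A^T F after exchanging
    \<open>l\<close> and \<open>m\<close>. For positive indices this is Pascal's rule; on the
    boundary only the corner survives.\<close>
  have pascal: "real ((l+m) choose m) - real (b l m) - real (b m l) = (if l = 0 \<and> m = 0 then 1 else 0)" for l m
  proof (cases "l = 0 \<or> m = 0")
    case False
    then obtain l' m' where lm: "l = Suc l'" "m = Suc m'"
      by (metis not0_implies_Suc)
    have "(m + l') choose l' = (m + l') choose m"
      using binomial_symmetric[of l' "m + l'"] by simp
    then show ?thesis by (simp add: lm b_def add.commute)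
  qed (auto simp: b_def)
  have "lyapunov_series N A k j + (\<Sum>i=1..N. lyapunov_series N A k i * A i j)
      + (\<Sum>i=1..N. lyapunov_series N A j i * A i k)
    = (\<Sum>l<N. \<Sum>m<N. (-1) ^ (l+m) * (real ((l+m) choose m) - real (b l m) - real (b m l)) * ?v l k * ?v m j)"
  proof -
    have "(\<Sum>i=1..N. lyapunov_series N A j i * A i k)
        = (\<Sum>l<N. \<Sum>m<N. - ((-1) ^ (l+m) * real (b m l) * ?v l k * ?v m j))"
      unfolding shift[OF kj(1)]
      by (rule trans[OF sum.swap]) (simp add: add.commute mult_ac)
    then show ?thesis
      unfolding shift[OF kj(2)]
      by (simp only: lyapunov_series_def[of N A k j] sum.distrib[symmetric])
        (intro sum.cong refl, simp add: algebra_simps)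
  qed
  also have "\<dots> = (\<Sum>l<N. \<Sum>m<N. if m = 0 then (if l = 0 then ?v 0 k * ?v 0 j else 0) else 0)"
    unfolding pascal by (intro sum.cong refl) auto
  also have "\<dots> = fvar N k * fvar N j"
    using N by simp
  finally show ?thesis .
qed

section \<open>Row sums of the series\<close>

text \<open>Upper negation turns the first two factors into (-l-1 choose m). With
  \<open>N = n + 1\<close> and the reflection of \<open>N choose (m+1)\<close>, Vandermonde yields
  (n - l choose n), which vanishes for \<open>0 < l \<le> n\<close>.\<close>

lemma alternating_binomial_sum:
  assumes "l < N"
  shows "(\<Sum>m<N. (-1) ^ m * real ((l+m) choose m) * real (N choose (m+1))) = (if l = 0 then 1 else 0)"
proof -
  obtain n where n: "N = Suc n" using assms by (cases N) auto
  have "(-1) ^ m * real ((l+m) choose m) * real (N choose (m+1))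
      = ((- (real l + 1)) gchoose m) * (real N gchoose (n - m))" if "m \<in> {0..n}" for m
  proof -
    have "(- (real l + 1)) gchoose m = (-1) ^ m * (real (l + m) gchoose m)"
      using gbinomial_minus[of "real l + 1" m]
      by (simp only: of_nat_add add.commute[of "real l" 1] add.assoc add_diff_cancel_left')
    moreover have "N choose (m+1) = N choose (n - m)"
      using that n binomial_symmetric[of "m+1" N] by simp
    ultimately show ?thesis by (simp add: binomial_gbinomial)
  qed
  then have "(\<Sum>m<N. (-1) ^ m * real ((l+m) choose m) * real (N choose (m+1)))
      = (\<Sum>m=0..n. ((- (real l + 1)) gchoose m) * (real N gchoose (n - m)))"
    unfolding n by (intro sum.cong) auto
  also have "\<dots> = (- (real l + 1) + real N) gchoose n"
    by (rule gbinomial_Vandermonde)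
  also have "- (real l + 1) + real N = real (n - l)"
    using assms n by (simp add: of_nat_diff)
  also have "real (n - l) gchoose n = real ((n - l) choose n)"
    by (simp add: binomial_gbinomial)
  also have "\<dots> = (if l = 0 then 1 else 0)"
    using assms n by (auto simp: binomial_eq_0)
  finally show ?thesis .
qed

text \<open>Summing over \<open>j\<close> leaves a combination of the rows e^T A^l whose
  coefficients are the alternating sums above; only \<open>l = 0\<close> survives.\<close>

lemma lyapunov_series_row_sum:
  assumes P: "\<And>m. m < N \<Longrightarrow> (\<Sum>j=1..N. row_iterate N A m j) = 1 / real N * real (N choose (m+1))"
    and N: "N \<ge> 1"
  shows "real N * (\<Sum>j=1..N. lyapunov_series N A k j) = fvar N k"
proof -
  let ?v = "row_iterate N A"
  have "real N * (\<Sum>j=1..N. lyapunov_series N A k j)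
     = real N * (\<Sum>l<N. \<Sum>m<N. \<Sum>j=1..N. (-1) ^ (l+m) * real ((l+m) choose m) * ?v l k * ?v m j)"
    unfolding lyapunov_series_def
    by (rule arg_cong[where f = "(*) (real N)"],
        rule trans[OF sum.swap], rule sum.cong[OF refl], rule sum.swap)
  also have "\<dots> = real N * (\<Sum>l<N. \<Sum>m<N. (-1) ^ (l+m) * real ((l+m) choose m) * ?v l k *
      (1 / real N * real (N choose (m+1))))"
    unfolding sum_distrib_left[symmetric]
    by (rule arg_cong[where f = "(*) (real N)"], intro sum.cong refl) (simp add: P del: One_nat_def)
  also have "\<dots> = (\<Sum>l<N. (-1) ^ l * ?v l k * (\<Sum>m<N. (-1) ^ m * real ((l+m) choose m) * real (N choose (m+1))))"
    unfolding sum_distrib_left using N by (intro sum.cong refl) (simp add: power_add)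
  also have "\<dots> = (\<Sum>l<N. if l = 0 then ?v 0 k else 0)"
    by (intro sum.cong refl, subst alternating_binomial_sum) auto
  also have "\<dots> = fvar N k"
    using N by simp
  finally show ?thesis .
qed

section \<open>Index chains and the rows e^T A^m\<close>

lemma index_chains_first_bounds:
  assumes "(i, j) \<in> index_chains n m" "m \<ge> 1"
  shows "1 \<le> j 1" "j 1 \<le> n"
proof -
  have "j 1 \<in> {1..n}"
    using assms by (intro PiE_mem[of j "{1..m}"]) (auto simp: index_chains_def)
  then show "1 \<le> j 1" "j 1 \<le> n" by auto
qed

lemma sum_chains_group:
  assumes "m \<ge> 1"
  shows "(\<Sum>(i, j)\<in>{(i, j)\<in>index_chains n m. p < j 1}. \<Prod>r=1..m. H (i r) (j r))
    = (\<Sum>a=Suc p..n. Q H n m a)"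
proof -
  let ?C = "\<lambda>a. {(i, j)\<in>index_chains n m. j 1 = a}"
  have fin: "finite (?C a)" for a
    by (rule finite_subset[OF _ finite_index_chains]) auto
  have "{(i, j)\<in>index_chains n m. p < j 1} = (\<Union>a\<in>{Suc p..n}. ?C a)"
    using index_chains_first_bounds[OF _ assms] by (auto simp: Suc_le_eq)
  then show ?thesis
    unfolding Q_def by (simp only:) (rule sum.UNION_disjoint, simp, use fin in blast, auto)
qed

lemma P_eq_sum_Q:
  assumes "m \<ge> 1"
  shows "P H n m = (\<Sum>a=1..n. Q H n m a)"
proof -
  have "{(i, j)\<in>index_chains n m. 0 < j 1} = index_chains n m"
    using index_chains_first_bounds(1)[OF _ assms] by (fastforce simp: Suc_le_eq)
  then show ?thesis
    using sum_chains_group[OF assms, where p = 0 and n = n and H = H] by (simp add: P_def)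
qed

lemma Q_1:
  assumes "1 \<le> a"
  shows "Q H n 1 a = (\<Sum>p=a..n. H p a)"
  unfolding Q_def
  by (rule sum.reindex_bij_witness[where
        j = "\<lambda>(i, j). i 1" and
        i = "\<lambda>p. (\<lambda>r\<in>{1..1}. p, \<lambda>r\<in>{1..1}. a)"])
    (use assms in \<open>auto simp: index_chains_def PiE_iff extensional_def fun_eq_iff\<close>)

text \<open>Removing the first pair (p, a) leaves a nonempty chain whose first column index exceeds
  p. \<open>push\<close> and \<open>tail\<close> are the two directions of this bijection.\<close>

lemma Q_Suc:
  assumes "m \<ge> 1" "a \<ge> 1"
  shows "Q H n (Suc m) a = (\<Sum>p=a..n. H p a * (\<Sum>b=Suc p..n. Q H n m b))"
proof -
  let ?T = "\<lambda>p. {(i, j)\<in>index_chains n m. p < j 1}"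
  define push :: "nat \<Rightarrow> (nat \<Rightarrow> nat) \<Rightarrow> nat \<Rightarrow> nat"
    where "push x f = (\<lambda>r\<in>{1..Suc m}. if r = 1 then x else f (r - 1))" for x f
  define tail :: "(nat \<Rightarrow> nat) \<Rightarrow> nat \<Rightarrow> nat"
    where "tail f = (\<lambda>r\<in>{1..m}. f (Suc r))" for f
  have fin: "finite (?T p)" for p
    by (rule finite_subset[OF _ finite_index_chains]) auto
  have tail_push: "tail (push x f) = f" if "f \<in> {1..m} \<rightarrow>\<^sub>E {1..n}" for x f
    using that by (auto simp: tail_def push_def fun_eq_iff PiE_iff extensional_def)
  have push_tail: "push (f (Suc 0)) (tail f) = f" if "f \<in> {1..Suc m} \<rightarrow>\<^sub>E {1..n}" for f
    using that by (auto simp: tail_def push_def fun_eq_iff PiE_iff extensional_def)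
  have push_1: "push x f (Suc 0) = x" and push_Suc: "r \<in> {1..m} \<Longrightarrow> push x f (Suc r) = f r" for x f r
    by (auto simp: push_def)
  \<comment> \<open>Separating the index 1 reduces the chain conditions after \<open>push\<close> to
    the new first pair, its link to the next one, and the conditions on the old chain.\<close>
  have split: "{1..Suc m} = insert 1 (Suc ` {1..m})" "{1..<Suc m} = insert 1 (Suc ` {1..<m})"
    using assms(1) by (auto simp: image_iff Bex_def le_Suc_eq)
  have tail_in: "tail f \<in> {1..m} \<rightarrow>\<^sub>E {1..n}" if "f \<in> {1..Suc m} \<rightarrow>\<^sub>E {1..n}" for f
    using that by (auto simp: tail_def PiE_iff)
  have push_in: "push x f \<in> {1..Suc m} \<rightarrow>\<^sub>E {1..n}" if "f \<in> {1..m} \<rightarrow>\<^sub>E {1..n}" "x \<in> {1..n}" for x f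
  proof (rule PiE_I)
    fix r assume "r \<in> {1..Suc m}"
    moreover have "f (r - 1) \<in> {1..n}" if "r \<in> {1..Suc m}" "r \<noteq> 1"
      using that by (intro PiE_mem[OF \<open>f \<in> _\<close>]) auto
    ultimately show "push x f r \<in> {1..n}"
      using that(2) by (simp add: push_def del: One_nat_def)
  qed (auto simp: push_def)
  have "(\<Sum>p=a..n. H p a * (\<Sum>b=Suc p..n. Q H n m b))
      = (\<Sum>p=a..n. \<Sum>(i, j)\<in>?T p. H p a * (\<Prod>r=1..m. H (i r) (j r)))"
    unfolding sum_chains_group[OF assms(1), symmetric] sum_distrib_left by (simp add: case_prod_beta)
  also have "\<dots> = (\<Sum>(p, i, j)\<in>(SIGMA p:{a..n}. ?T p). H p a * (\<Prod>r=1..m. H (i r) (j r)))"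
    using fin by (subst sum.Sigma) auto
  also have "\<dots> = Q H n (Suc m) a"
    unfolding Q_def
  proof (rule sum.reindex_bij_witness[where
        i = "\<lambda>(i, j). (i 1, tail i, tail j)" and
        j = "\<lambda>(p, i, j). (push p i, push a j)"], goal_cases)
    case (1 x)
    then show ?case
      by (auto simp: index_chains_def tail_push push_1)
  next
    case (2 x)
    then obtain p i j where x: "x = (p, i, j)" "p \<in> {a..n}" "(i, j) \<in> index_chains n m" "p < j 1"
      by auto
    then have ij: "i \<in> {1..m} \<rightarrow>\<^sub>E {1..n}" "j \<in> {1..m} \<rightarrow>\<^sub>E {1..n}"
      by (auto simp: index_chains_def)
    then have "push p i \<in> {1..Suc m} \<rightarrow>\<^sub>E {1..n}" "push a j \<in> {1..Suc m} \<rightarrow>\<^sub>E {1..n}"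
      using push_in[OF ij(1), of p] push_in[OF ij(2), of a] x(2) assms(2) by simp_all
    moreover have "\<forall>r\<in>{1..Suc m}. push a j r \<le> push p i r"
      unfolding split using x
      by (auto simp: push_1 push_Suc index_chains_def simp del: image_Suc_atLeastAtMost)
    moreover have "\<forall>r\<in>{1..<Suc m}. push p i r < push a j (Suc r)"
      unfolding split using x assms(1)
      by (auto simp: push_1 push_Suc index_chains_def simp del: image_Suc_atLeastLessThan)
    ultimately show ?case
      by (simp add: x index_chains_def push_1)
  next
    case (3 y)
    then show ?case
      by (auto simp: index_chains_def push_tail)
  next
    case (4 y)
    then obtain i j where y: "y = (i, j)" "(i, j) \<in> index_chains n (Suc m)" "j 1 = a"
      by auto
    then have ij: "i \<in> {1..Suc m} \<rightarrow>\<^sub>E {1..n}" "j \<in> {1..Suc m} \<rightarrow>\<^sub>E {1..n}"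
        "\<And>r. r \<in> {1..Suc m} \<Longrightarrow> j r \<le> i r" "\<And>r. r \<in> {1..<Suc m} \<Longrightarrow> i r < j (Suc r)"
      by (auto simp: index_chains_def)
    have "(tail i, tail j) \<in> index_chains n m"
      using ij tail_in by (auto simp: index_chains_def tail_def)
    moreover have "i 1 < tail j 1"
      using ij(4)[of 1] assms(1) by (simp add: tail_def)
    moreover have "i 1 \<in> {a..n}"
      using ij(1) ij(3)[of 1] y(3) by (auto simp: PiE_iff)
    ultimately show ?case by (simp add: y)
  next
    case (5 x)
    obtain p i j where x: "x = (p, i, j)"
      by (cases x)
    have "(\<Prod>r=1..Suc m. H (push p i r) (push a j r)) = H p a * (\<Prod>r=1..m. H (i r) (j r))"
      unfolding split(1)
      by (subst prod.insert) (auto simp: prod.reindex push_1 push_Suc simp del: image_Suc_atLeastAtMost)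
    then show ?case by (simp add: x)
  qed
  finally show ?thesis ..
qed

text \<open>Multiplication by A, with the order of summation over \<open>b\<close> and
  \<open>p\<close> exchanged, is exactly the recursion \<open>Q_Suc\<close>.\<close>

lemma row_iterate_eq_Q:
  assumes "m \<ge> 1" "a \<ge> 1" and N: "N \<ge> 1"
  shows "row_iterate N (partial_col_sum H) m a = Q H (N-1) m a"
  using assms(1,2)
proof (induction m arbitrary: a rule: nat_induct_at_least)
  case base
  have "{a..<N} = {a..N-1}"
    using N by auto
  then show ?case
    using Q_1[OF base, of H "N-1"] N
    by (simp add: fvar_def partial_col_sum_def if_distrib[of "\<lambda>c. c * _"] cong: if_cong)
next
  case (Suc m)
  let ?v = "row_iterate N (partial_col_sum H) m"
  have "row_iterate N (partial_col_sum H) (Suc m) a = (\<Sum>b=1..N. \<Sum>p=a..<b. ?v b * H p a)"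
    by (simp add: partial_col_sum_def sum_distrib_left)
  \<comment> \<open>For \<open>m \<ge> 1\<close> the row vanishes in column N, which reconciles size
    N of A with size N - 1 of \<open>H\<close>.\<close>
  also have "\<dots> = (\<Sum>b=1..N-1. \<Sum>p=a..<b. ?v b * H p a)"
  proof (rule sum.mono_neutral_right)
    have "?v N = 0"
      using Suc.hyps by (intro row_iterate_eq_0 partial_col_sum_eq_0) auto
    then show "\<forall>b\<in>{1..N} - {1..N-1}. (\<Sum>p=a..<b. ?v b * H p a) = 0"
      by (auto simp: le_less_Suc_eq dest!: le_antisym)
  qed auto
  also have "\<dots> = (\<Sum>b=1..N-1. \<Sum>p=a..N-1. if p < b then Q H (N-1) m b * H p a else 0)"
  proof (rule sum.cong)
    fix b assume b: "b \<in> {1..N-1}"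
    then have "{a..<b} = {p\<in>{a..N-1}. p < b}" by auto
    moreover have "?v b = Q H (N-1) m b" using b by (intro Suc.IH) auto
    ultimately show "(\<Sum>p=a..<b. ?v b * H p a) = (\<Sum>p=a..N-1. if p < b then Q H (N-1) m b * H p a else 0)"
      by (simp only: sum.inter_filter finite_atLeastAtMost)
  qed simp
  also have "\<dots> = (\<Sum>p=a..N-1. \<Sum>b=1..N-1. if p < b then Q H (N-1) m b * H p a else 0)"
    by (rule sum.swap)
  also have "\<dots> = (\<Sum>p=a..N-1. H p a * (\<Sum>b=Suc p..N-1. Q H (N-1) m b))"
  proof (rule sum.cong)
    fix p
    have "{Suc p..N-1} = {b\<in>{1..N-1}. p < b}" by auto
    then show "(\<Sum>b=1..N-1. if p < b then Q H (N-1) m b * H p a else 0)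
        = H p a * (\<Sum>b=Suc p..N-1. Q H (N-1) m b)"
      by (simp only: sum.inter_filter finite_atLeastAtMost sum_distrib_left)
        (simp add: mult.commute if_distrib cong: if_cong)
  qed simp
  also have "\<dots> = Q H (N-1) (Suc m) a"
    using Suc.hyps Suc.prems by (simp add: Q_Suc)
  finally show ?case .
qed

lemma sum_row_iterate_eq_P:
  assumes N: "N \<ge> 1"
  shows "(\<Sum>j=1..N. row_iterate N (partial_col_sum H) m j) = P H (N-1) m"
proof (cases "m = 0")
  case True
  then show ?thesis using N by (simp add: P_0 fvar_def)
next
  case False
  have "row_iterate N (partial_col_sum H) m N = 0"
    using False by (intro row_iterate_eq_0 partial_col_sum_eq_0) auto
  then have "(\<Sum>j=1..N. row_iterate N (partial_col_sum H) m j)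
      = (\<Sum>j=1..N-1. row_iterate N (partial_col_sum H) m j)"
    using N by (cases N) auto
  also have "\<dots> = P H (N-1) m"
    using False N by (simp add: P_eq_sum_Q row_iterate_eq_Q)
  finally show ?thesis .
qed

text \<open>The column indices of a chain increase strictly from \<open>a\<close> to at most N - 1,
  so its length is at most N - a; here this is read off from the nilpotency of A.\<close>

lemma Q_eq_0:
  assumes "N \<ge> 1" "m \<ge> 1" "a \<ge> 1" "N < a + m"
  shows "Q H (N-1) m a = 0"
  using row_iterate_eq_0[of "partial_col_sum H" N a m] assms
  by (simp add: partial_col_sum_eq_0 row_iterate_eq_Q)

lemma sum_Q_truncate:
  assumes "N \<ge> 1" "a \<ge> 1"
  shows "(\<Sum>m=1..N-1. Q H (N-1) m a * f m) = (\<Sum>m=1..N-a. Q H (N-1) m a * f m)"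
proof (rule sum.mono_neutral_right)
  show "\<forall>m\<in>{1..N-1} - {1..N-a}. Q H (N-1) m a * f m = 0"
    using assms by (intro ballI) (subst Q_eq_0, auto)
qed (use assms in auto)

section \<open>Uniqueness and the closed form\<close>

text \<open>The difference of the two Laplacians solves the homogeneous equation, and the
  multipliers are recovered from off-diagonal entries.\<close>

lemma laplacian_unique:
  assumes "\<forall>k\<in>{1..N}. \<forall>j\<in>{1..k}. s_coeff N H lam k j = 0"
    and "\<forall>k\<in>{1..N}. \<forall>j\<in>{1..k}. s_coeff N H \<mu> k j = 0"
    and "k \<in> {1..N}" "j \<in> {1..k-1}"
  shows "\<mu> k j = lam k j"
proof -
  let ?A = "partial_col_sum H"
  define E where "E k j = laplacian N \<mu> k j - laplacian N lam k j" for k j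
  have *: "laplacian N \<nu> k j + (\<Sum>i=1..N. laplacian N \<nu> k i * ?A i j) + (\<Sum>i=1..N. laplacian N \<nu> j i * ?A i k)
      = (real N - 1) * fvar N k * fvar N j - fvar N k * ?A N j - fvar N j * ?A N k"
    if s: "\<forall>k\<in>{1..N}. \<forall>j\<in>{1..k}. s_coeff N H \<nu> k j = 0" and kj: "k \<in> {1..N}" "j \<in> {1..N}" for \<nu> k j
  \<comment> \<open>The system covers only \<open>j \<le> k\<close>; the other entries follow
    because the equation is symmetric.\<close>
  proof (cases "j \<le> k")
    case True
    then have "s_coeff N H \<nu> k j = 0" using s kj by auto
    then show ?thesis
      unfolding s_coeff_eq_lyapunov[OF kj] by (simp split: if_splits)
  next
    case False
    then have "s_coeff N H \<nu> j k = 0" using s kj by auto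
    then show ?thesis
      unfolding s_coeff_eq_lyapunov[OF kj(2,1)] laplacian_sym[of N \<nu> j k]
      by (simp add: mult_ac split: if_splits)
  qed
  have "E k j = 0"
  proof (rule lyapunov_homogeneous_eq_0[of ?A])
    fix k j assume kj: "k \<in> {1..N}" "j \<in> {1..N}"
    show "E k j + (\<Sum>i=1..N. E k i * ?A i j) + (\<Sum>i=1..N. E j i * ?A i k) = 0"
      using *[OF assms(1) kj] *[OF assms(2) kj]
      by (simp add: E_def left_diff_distrib sum_subtractf)
  qed (use assms(3,4) in \<open>auto simp: partial_col_sum_eq_0\<close>)
  moreover have "j < k"
    using assms(4) by auto
  ultimately show ?thesis
    by (simp add: E_def laplacian_def)
qed

theorem theorem5:
  fixes N :: nat and H :: "nat \<Rightarrow> nat \<Rightarrow> real"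
  assumes "N \<ge> 2"
    and "lower_triangular (N-1) H"
    and "\<forall>m\<in>{1..N-1}. P H (N-1) m = 1 / real N * real (N choose (m+1))"
  shows "\<exists>lam.
    (\<forall>k\<in>{1..N}. \<forall>j\<in>{1..k}. s_coeff N H lam k j = 0) \<and>
    (\<forall>\<mu>. (\<forall>k\<in>{1..N}. \<forall>j\<in>{1..k}. s_coeff N H \<mu> k j = 0) \<longrightarrow>
       (\<forall>k\<in>{1..N}. \<forall>j\<in>{1..k-1}. \<mu> k j = lam k j)) \<and>
    (\<forall>j\<in>{1..N-1}.
       lam N j = 1 / D H N * (\<Sum>m=1..N-1. (-1) ^ (m-1) * Q H (N-1) m j) \<and>
       lam N j = real N * (\<Sum>m=1..N-j. (-1) ^ (m-1) * Q H (N-1) m j)) \<and>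
    (\<forall>k\<in>{1..N-1}. \<forall>j\<in>{1..k-1}.
       lam k j = 1 / D H N * (\<Sum>l=1..N-1. \<Sum>m=1..N-1.
         (-1) ^ (l+m-1) * real ((l+m) choose m) * Q H (N-1) l j * Q H (N-1) m k) \<and>
       lam k j = real N * (\<Sum>l=1..N-j. \<Sum>m=1..N-k.
         (-1) ^ (l+m-1) * real ((l+m) choose m) * Q H (N-1) l j * Q H (N-1) m k))"
proof -
  define A where "A = partial_col_sum H"
  have A0: "A i j = 0" if "i \<le> j" for i j
    using that by (simp add: A_def partial_col_sum_eq_0)
  have N: "N \<ge> 1" using assms(1) by simp
  \<comment> \<open>Under X -> X + X A + A^T X the term N F goes to N e e^T and e e^T to e e^T + e
    e^T A + A^T e e^T; the difference is R.\<close>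
  define L where "L k j = real N * lyapunov_series N A k j - fvar N k * fvar N j" for k j
  define lam where "lam k j = - L k j" for k j
  have L_sym: "L k j = L j k" for k j
    by (simp add: L_def lyapunov_series_sym[of N A k j])
  have L_rows: "(\<Sum>j=1..N. L k j) = 0" for k
  proof -
    have "(\<Sum>j=1..N. row_iterate N A m j) = 1 / real N * real (N choose (m+1))" if "m < N" for m
      using that assms(3) N unfolding A_def sum_row_iterate_eq_P[OF N]
      by (cases "m = 0") (auto simp: P_0)
    then have "real N * (\<Sum>j=1..N. lyapunov_series N A k j) = fvar N k"
      using N by (rule lyapunov_series_row_sum)
    moreover have "(\<Sum>j=1..N. fvar N j) = 1"
      using N by (simp add: fvar_def)
    ultimately show ?thesis
      by (simp add: L_def sum_subtractf sum_distrib_left[symmetric])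
  qed
  \<comment> \<open>Off the diagonal this is the choice of \<open>lam\<close>; on the diagonal it is
    the vanishing of the row sums.\<close>
  have lap: "laplacian N lam k j = L k j" if k: "k \<in> {1..N}" for k j
  proof -
    have off: "lam (max k i) (min k i) = - L k i" for i
      by (auto simp: lam_def max_def min_def L_sym)
    have "(\<Sum>i\<in>{1..N} - {k}. - L k i) = L k k"
      using L_rows[of k] sum.remove[OF _ k, of "L k"] by (simp add: sum_negf)
    then have "laplacian N lam k k = L k k"
      by (simp add: laplacian_def off)
    moreover have "laplacian N lam k j = L k j" if "k \<noteq> j"
      using that by (simp add: laplacian_def off)
    ultimately show ?thesis
      by (cases "k = j") auto
  qed
  have LA: "(\<Sum>i=1..N. L k i * A i j) = real N * (\<Sum>i=1..N. lyapunov_series N A k i * A i j) - fvar N k * A N j"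
    for k j
  proof -
    have "(\<Sum>i=1..N. fvar N i * A i j) = A N j"
      using N by (simp add: fvar_def if_distrib[of "\<lambda>c. c * _"] cong: if_cong)
    then show ?thesis
      by (simp add: L_def left_diff_distrib sum_subtractf sum_distrib_left[symmetric] mult.assoc)
  qed
  have sol: "\<forall>k\<in>{1..N}. \<forall>j\<in>{1..k}. s_coeff N H lam k j = 0"
  proof (intro ballI)
    fix k j assume "k \<in> {1..N}" "j \<in> {1..k}"
    then have kj: "k \<in> {1..N}" "j \<in> {1..N}" by auto
    have "L k j + (\<Sum>i=1..N. L k i * A i j) + (\<Sum>i=1..N. L j i * A i k)
      = real N * (lyapunov_series N A k j + (\<Sum>i=1..N. lyapunov_series N A k i * A i j)
        + (\<Sum>i=1..N. lyapunov_series N A j i * A i k)) - fvar N k * fvar N j - fvar N k * A N j - fvar N j * A N k"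
      unfolding LA by (simp add: L_def algebra_simps)
    also have "\<dots> = (real N - 1) * fvar N k * fvar N j - fvar N k * A N j - fvar N j * A N k"
      by (subst lyapunov_series_eq[OF _ N kj]) (simp_all add: A0 algebra_simps)
    finally show "s_coeff N H lam k j = 0"
      unfolding s_coeff_eq_lyapunov[OF kj] lap[OF kj(1)] lap[OF kj(2)] A_def[symmetric] by simp
  qed
  have v: "row_iterate N A m a = Q H (N-1) m a" if "m \<ge> 1" "a \<ge> 1" for m a
    using that N by (simp add: A_def row_iterate_eq_Q)
  \<comment> \<open>The index 0 is split off because \<open>Q\<close> describes e^T A^m only for
    \<open>m \<ge> 1\<close>.\<close>
  have range: "(\<Sum>m<N. f m) = f 0 + (\<Sum>m=1..N-1. f m)" for f :: "nat \<Rightarrow> real"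
    using N by (cases N) (simp_all add: sum.atLeast1_atMost_eq sum.lessThan_Suc_shift del: sum.lessThan_Suc)
  have DN: "1 / D H N = real N"
    using D_eq[OF N, of H] assms(3) by simp
  have v0: "row_iterate N A 0 a = 0" if "a \<in> {1..N-1}" for a
    using that by (auto simp: fvar_def)
  have last: "lam N j = real N * (\<Sum>m=1..N-1. (-1) ^ (m-1) * Q H (N-1) m j)" if j: "j \<in> {1..N-1}" for j
  proof -
    \<comment> \<open>In row N of F only \<open>l = 0\<close> remains, where the binomial
      coefficient is 1.\<close>
    have z: "row_iterate N A l N = 0" if "l \<ge> 1" for l
      using that by (intro row_iterate_eq_0 A0) auto
    have "lyapunov_series N A N j = (\<Sum>m<N. (-1) ^ m * row_iterate N A m j)"
      unfolding lyapunov_series_def range by (simp add: z fvar_def)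
    also have "\<dots> = (\<Sum>m=1..N-1. (-1) ^ m * Q H (N-1) m j)"
      unfolding range v0[OF j] using j by (simp add: v)
    also have "\<dots> = - (\<Sum>m=1..N-1. (-1) ^ (m-1) * Q H (N-1) m j)"
      unfolding sum_negf[symmetric]
      by (intro sum.cong refl) (auto simp: power_eq_if)
    finally show ?thesis
      using j by (auto simp: lam_def L_def fvar_def)
  qed
  have inner: "lam k j = real N * (\<Sum>l=1..N-1. \<Sum>m=1..N-1.
      (-1) ^ (l+m-1) * real ((l+m) choose m) * Q H (N-1) l j * Q H (N-1) m k)"
    if k: "k \<in> {1..N-1}" and j: "j \<in> {1..k-1}" for k j
  proof -
    have j': "j \<in> {1..N-1}" using k j by auto
    \<comment> \<open>Below index N the terms with \<open>l = 0\<close> or \<open>m = 0\<close>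
      vanish. The transposed entry pairs \<open>l\<close> with \<open>j\<close> as in the
      claim.\<close>
    have "lyapunov_series N A j k = (\<Sum>l=1..N-1. \<Sum>m=1..N-1.
        (-1) ^ (l+m) * real ((l+m) choose m) * Q H (N-1) l j * Q H (N-1) m k)"
      unfolding lyapunov_series_def range v0[OF k] v0[OF j'] using k j by (simp add: v)
    also have "\<dots> = - (\<Sum>l=1..N-1. \<Sum>m=1..N-1.
        (-1) ^ (l+m-1) * real ((l+m) choose m) * Q H (N-1) l j * Q H (N-1) m k)"
      unfolding sum_negf[symmetric]
      by (intro sum.cong refl) (auto simp: power_eq_if)
    finally show ?thesis
      using k j by (auto simp: lam_def L_def fvar_def lyapunov_series_sym[of N A k j])
  qed
  have last_trunc: "(\<Sum>m=1..N-1. (-1) ^ (m-1) * Q H (N-1) m j)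
      = (\<Sum>m=1..N-j. (-1) ^ (m-1) * Q H (N-1) m j)" if "j \<ge> 1" for j
    using sum_Q_truncate[OF N that, of H "\<lambda>m. (-1) ^ (m-1)"] by (simp add: mult.commute)
  have inner_trunc: "(\<Sum>l=1..N-1. \<Sum>m=1..N-1.
      (-1) ^ (l+m-1) * real ((l+m) choose m) * Q H (N-1) l j * Q H (N-1) m k)
    = (\<Sum>l=1..N-j. \<Sum>m=1..N-k.
      (-1) ^ (l+m-1) * real ((l+m) choose m) * Q H (N-1) l j * Q H (N-1) m k)" if "j \<ge> 1" "k \<ge> 1" for j k
  proof -
    let ?c = "\<lambda>l m. (-1) ^ (l+m-1) * real ((l+m) choose m)"
    have "(\<Sum>l=1..N-1. Q H (N-1) l j * (\<Sum>m=1..N-1. Q H (N-1) m k * ?c l m))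
        = (\<Sum>l=1..N-j. Q H (N-1) l j * (\<Sum>m=1..N-k. Q H (N-1) m k * ?c l m))"
      using that N by (simp only: sum_Q_truncate)
    then show ?thesis
      by (simp add: sum_distrib_left mult_ac)
  qed
  have "\<forall>\<mu>. (\<forall>k\<in>{1..N}. \<forall>j\<in>{1..k}. s_coeff N H \<mu> k j = 0) \<longrightarrow>
       (\<forall>k\<in>{1..N}. \<forall>j\<in>{1..k-1}. \<mu> k j = lam k j)"
    using laplacian_unique[OF sol] by blast
  moreover have "\<forall>j\<in>{1..N-1}.
       lam N j = 1 / D H N * (\<Sum>m=1..N-1. (-1) ^ (m-1) * Q H (N-1) m j) \<and>
       lam N j = real N * (\<Sum>m=1..N-j. (-1) ^ (m-1) * Q H (N-1) m j)"
  proof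
    fix j assume j: "j \<in> {1..N-1}"
    then have "j \<ge> 1" by simp
    then show "lam N j = 1 / D H N * (\<Sum>m=1..N-1. (-1) ^ (m-1) * Q H (N-1) m j) \<and>
       lam N j = real N * (\<Sum>m=1..N-j. (-1) ^ (m-1) * Q H (N-1) m j)"
      unfolding DN last_trunc[OF \<open>j \<ge> 1\<close>, symmetric] using last[OF j] by (intro conjI)
  qed
  moreover have "\<forall>k\<in>{1..N-1}. \<forall>j\<in>{1..k-1}.
       lam k j = 1 / D H N * (\<Sum>l=1..N-1. \<Sum>m=1..N-1.
         (-1) ^ (l+m-1) * real ((l+m) choose m) * Q H (N-1) l j * Q H (N-1) m k) \<and>
       lam k j = real N * (\<Sum>l=1..N-j. \<Sum>m=1..N-k.
         (-1) ^ (l+m-1) * real ((l+m) choose m) * Q H (N-1) l j * Q H (N-1) m k)"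
  proof (intro ballI)
    fix k j assume kj: "k \<in> {1..N-1}" "j \<in> {1..k-1}"
    then have "j \<ge> 1" "k \<ge> 1" by simp_all
    then show "lam k j = 1 / D H N * (\<Sum>l=1..N-1. \<Sum>m=1..N-1.
         (-1) ^ (l+m-1) * real ((l+m) choose m) * Q H (N-1) l j * Q H (N-1) m k) \<and>
       lam k j = real N * (\<Sum>l=1..N-j. \<Sum>m=1..N-k.
         (-1) ^ (l+m-1) * real ((l+m) choose m) * Q H (N-1) l j * Q H (N-1) m k)"
      unfolding DN inner_trunc[OF \<open>j \<ge> 1\<close> \<open>k \<ge> 1\<close>, symmetric] using inner[OF kj] by (intro conjI)
  qed
  ultimately show ?thesis
    using sol by (intro exI[of _ lam] conjI)
qed


end
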